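(* Let $\Lambda = (P,Q) \in C^2(\mathbb{R}^2,\mathbb{R}^2)$ be a non-singular map, i.e. the Jacobian matrix $J(z)$ of $\Lambda$ at $z$ is invertible for every $z \in \mathbb{R}^2$. If at least one of the components $P, Q : \mathbb{R}^2 \to \mathbb{R}$ is a convex function (not necessarily strictly convex), then $\Lambda$ is injective on $\mathbb{R}^2$.
   Context: A map $\Lambda = (P,Q) \in C^2(\mathbb{R}^2,\mathbb{R}^2)$ is called non-singular if its Jacobian matrix $J(z)$ is non-singular (has nonzero determinant) at every point $z \in \mathbb{R}^2$. Convexity is meant in the usual non-strict sense: $f(tz + (1-t)w) \le t f(z) + (1-t) f(w)$ for all $z,w \in \mathbb{R}^2$ and $t \in [0,1]$. *)

theory Defs
  imports "HOL-Analysis.Analysis"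
begin

text \<open>
  Class \<open>C\<^sup>2\<close> on the whole space, in the Frechet sense: the derivative \<open>z \<mapsto> Df(z)\<close>, as a map into
  the bounded linear operators, is itself differentiable with continuous derivative. On
  \<open>\<real>\<^sup>n\<close> this is the same as existence and continuity of all partial derivatives of order at most 2.
\<close>

definition C2_map :: "('a::real_normed_vector \<Rightarrow> 'b::real_normed_vector) \<Rightarrow> bool" where
  "C2_map f \<longleftrightarrow>
    (\<exists>(f' :: 'a \<Rightarrow> 'a \<Rightarrow>\<^sub>L 'b) (f'' :: 'a \<Rightarrow> 'a \<Rightarrow>\<^sub>L ('a \<Rightarrow>\<^sub>L 'b)).
      (\<forall>z. (f has_derivative blinfun_apply (f' z)) (at z)) \<and>
      (\<forall>z. (f' has_derivative blinfun_apply (f'' z)) (at z)) \<and>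
      continuous_on UNIV f'')"

definition nonsingular_map :: "(real^'n \<Rightarrow> real^'n) \<Rightarrow> bool" where
  "nonsingular_map f \<longleftrightarrow> (\<forall>z. det (jacobian f (at z)) \<noteq> 0)"

end

theory Submission
  imports Defs
begin

text \<open>
  Let \<open>P\<close> be convex and suppose \<open>\<Lambda> a = \<Lambda> b\<close> with \<open>a \<noteq> b\<close>, \<open>c = P a\<close>. If \<open>P\<close> takes the value \<open>c\<close> at
  an inner point of the segment \<open>[a, b]\<close>, then it is constant there, while by Rolle's theorem the
  derivative of \<open>Q\<close> along the segment vanishes somewhere, which contradicts nonsingularity.
  Otherwise let \<open>z\<^sub>0\<close> be a minimum point of \<open>P\<close> on the segment; the linear form \<open>L = DP(z\<^sub>0)\<close>
  vanishes on \<open>b - a\<close> but is not zero. The tangent inequalities of \<open>P\<close> at \<open>z\<^sub>0\<close>, \<open>a\<close> and \<open>b\<close> show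
  that the arc \<open>A = {P = c} \<inter> {L (z - a) \<ge> 0}\<close> is compact. As \<open>\<Lambda>\<close> is open, \<open>Q\<close> restricted to \<open>A\<close> has
  no extremum at a point with \<open>L (z - a) > 0\<close>, so both its extrema are attained on the line through
  \<open>a\<close> and \<open>b\<close>, hence at \<open>a\<close> or \<open>b\<close>, where \<open>Q\<close> has the same value. Thus \<open>Q\<close> is constant on \<open>A\<close>,
  although \<open>A\<close> contains points with \<open>L (z - a) > 0\<close>.
\<close>

section \<open>Tangent inequality, and openness of a planar map with invertible derivative\<close>

lemma convex_on_tangent_le:
  fixes f :: "'a::real_normed_vector \<Rightarrow> real"
  assumes cvx: "convex_on UNIV f" and der: "(f has_derivative f') (at x)"
  shows "f x + f' (y - x) \<le> f y"
proof -
  \<comment> \<open>Restriction to the line through \<open>x\<close> and \<open>y\<close> reduces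
    the claim to the tangent inequality in one variable.\<close>
  define g where "g t = f (x + t *\<^sub>R (y - x))" for t
  have comb: "x + ((1 - s) * p + s * q) *\<^sub>R (y - x)
      = (1 - s) *\<^sub>R (x + p *\<^sub>R (y - x)) + s *\<^sub>R (x + q *\<^sub>R (y - x))" for s p q :: real
    by (simp add: algebra_simps)
  have "convex_on UNIV g"
  proof (rule convex_onI)
    fix s p q :: real
    assume "0 < s" "s < 1"
    then show "g ((1 - s) *\<^sub>R p + s *\<^sub>R q) \<le> (1 - s) * g p + s * g q"
      unfolding g_def real_scaleR_def comb
      using convex_onD[OF cvx, of s] by simp
  qed simp
  moreover have "(g has_field_derivative f' (y - x)) (at 0)"
  proof -
    have "((\<lambda>t. x + t *\<^sub>R (y - x)) has_derivative (\<lambda>t. t *\<^sub>R (y - x))) (at 0)"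
      by (auto intro!: derivative_eq_intros)
    moreover have "(f has_derivative f') (at (x + 0 *\<^sub>R (y - x)))"
      using der by simp
    ultimately have "(g has_derivative (\<lambda>t. f' (t *\<^sub>R (y - x)))) (at 0)"
      unfolding g_def by (rule has_derivative_compose)
    moreover have "f' (t *\<^sub>R (y - x)) = f' (y - x) * t" for t
      using linear_scale[OF has_derivative_linear[OF der]] by simp
    ultimately show ?thesis
      by (simp add: has_field_derivative_def)
  qed
  ultimately have "f' (y - x) * (1 - 0) \<le> g 1 - g 0"
    by (intro convex_on_imp_above_tangent[where A = UNIV]) auto
  then show ?thesis
    by (simp add: g_def)
qed

text \<open>An injective linear map between spaces of dimension 2 is bijective. The inverse serves
  twice: it feeds the open mapping theorem, and its value at (1, 0) is a direction transversal to
  the chord.\<close>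

lemma linear_pair_isomorphism:
  fixes p q :: "'a::euclidean_space \<Rightarrow> real"
  assumes dim: "DIM('a) = 2" and lin: "linear p" "linear q"
    and ker: "\<And>v. p v = 0 \<Longrightarrow> q v = 0 \<Longrightarrow> v = 0"
  obtains g where "linear g" "\<And>r. p (g r) = fst r" "\<And>r. q (g r) = snd r"
proof -
  let ?T = "\<lambda>v. (p v, q v)"
  have T: "linear ?T"
    using lin by (auto simp: linear_iff)
  moreover have "inj ?T"
    using ker by (auto simp: linear_injective_0[OF T] zero_prod_def)
  moreover have "dim (UNIV :: 'a set) = dim (UNIV :: (real \<times> real) set)"
    by (simp add: dim)
  ultimately obtain g where "linear g" "\<And>r. ?T (g r) = r"
    using linear_injective_isomorphism[of ?T] by metis
  then show thesis
    by (metis that fst_conv snd_conv)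
qed

text \<open>The derivative of (P, Q) at \<open>x\<close> is invertible, so the image of
  \<open>U\<close> contains a ball around (P x, Q x). Minima are covered by applying this to -
  Q.\<close>

lemma no_constrained_local_max:
  fixes P Q :: "'a::euclidean_space \<Rightarrow> real"
  assumes dim: "DIM('a) = 2"
    and P: "\<And>z. (P has_derivative P' z) (at z)"
    and Q: "\<And>z. (Q has_derivative Q' z) (at z)"
    and ker: "\<And>z v. P' z v = 0 \<Longrightarrow> Q' z v = 0 \<Longrightarrow> v = 0"
    and "open U" "x \<in> U"
  shows "\<exists>z\<in>U. P z = P x \<and> Q x < Q z"
proof -
  let ?F = "\<lambda>z. (P z, Q z)" and ?F' = "\<lambda>v. (P' x v, Q' x v)"
  have F: "(?F has_derivative (\<lambda>v. (P' z v, Q' z v))) (at z)" for z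
    using P Q by (rule has_derivative_Pair)
  obtain g where g: "linear g" "\<And>r. P' x (g r) = fst r" "\<And>r. Q' x (g r) = snd r"
    by (rule linear_pair_isomorphism[OF dim has_derivative_linear[OF P[of x]] has_derivative_linear[OF Q[of x]]])
      (auto intro: ker)
  have "?F x \<in> interior (?F ` U)"
  proof (rule sussmann_open_mapping[of UNIV ?F x ?F' g])
    show "continuous_on UNIV ?F"
      by (intro continuous_at_imp_continuous_on ballI has_derivative_continuous[OF F])
    show "?F' \<circ> g = id"
      by (auto simp: g)
    show "(?F has_derivative ?F') (at x)"
      by (rule F)
    show "bounded_linear g"
      using g by (simp add: linear_conv_bounded_linear)
    show "x \<in> interior U"
      using assms by (simp add: interior_open)
  qed simp_all
  then obtain e where e: "e > 0" "cball (?F x) e \<subseteq> ?F ` U"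
    by (auto simp: mem_interior_cball)
  \<comment> \<open>Moving vertically inside the ball raises Q while P keeps its value.\<close>
  have "(P x, Q x + e) \<in> cball (?F x) e"
    using e(1) by (simp add: dist_Pair_Pair dist_real_def)
  with e(2) have "(P x, Q x + e) \<in> ?F ` U"
    by (rule subsetD)
  then obtain z where "z \<in> U" "P z = P x" "Q z = Q x + e"
    by auto
  then show ?thesis
    using e(1) by force
qed

section \<open>Compactness of the level arc on one side of the chord\<close>

lemma convex_level_arc_compact:
  fixes P :: "'a::euclidean_space \<Rightarrow> real"
  assumes cvx: "convex_on UNIV P" and P: "\<And>z. (P has_derivative P' z) (at z)"
    and ab: "P a = c" "P b = c" and \<alpha>: "P' a (b - a) < 0" and \<beta>: "0 < P' b (b - a)"
    and split: "\<And>w. \<exists>s. w = s *\<^sub>R (b - a) + P' z0 w *\<^sub>R n"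
  shows "compact {z. P z = c \<and> 0 \<le> P' z0 (z - a)}" (is "compact ?A")
proof -
  note tangent = convex_on_tangent_le[OF cvx P]
  note lin = has_derivative_linear[OF P]
  note lins = linear_add[OF lin] linear_diff[OF lin] linear_scale[OF lin]
  \<comment> \<open>In the coordinates z - a = s (b - a) + t n with t =
    \<open>P' z0 (z - a)\<close>, the tangent inequality at \<open>z0\<close> gives t \<le>
    \<open>M\<close>, the one at \<open>a\<close> gives \<open>s1\<close> \<le> s, and the one at
    \<open>b\<close> gives s \<le> \<open>s2\<close>. So the arc lies in the image of a rectangle
    under \<open>h\<close>.\<close>
  define M where "M = c - P z0 - P' z0 (a - z0)"
  define s1 where "s1 = - M * \<bar>P' a n\<bar> / - P' a (b - a)"
  define s2 where "s2 = 1 + M * \<bar>P' b n\<bar> / P' b (b - a)"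
  define h where "h = (\<lambda>(s, t). a + s *\<^sub>R (b - a) + t *\<^sub>R n)"
  have "?A \<subseteq> h ` ({s1..s2} \<times> {0..M})"
  proof
    fix z assume z: "z \<in> ?A"
    define t where "t = P' z0 (z - a)"
    obtain s where s: "z - a = s *\<^sub>R (b - a) + t *\<^sub>R n"
      using split t_def by metis
    have t0: "0 \<le> t"
      using z by (simp add: t_def)
    have "P' z0 (z - z0) = t + P' z0 (a - z0)"
      by (simp add: t_def lins)
    then have tM: "t \<le> M"
      using tangent[of z0 z] z by (simp add: M_def)
    have bound: "\<bar>t * r\<bar> \<le> M * \<bar>r\<bar>" for r
      using t0 tM by (simp add: abs_mult mult_right_mono)
    have "P' a (z - a) = s * P' a (b - a) + t * P' a n"
      by (simp add: s lins del: diff_add_eq_diff_diff_swap)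
    then have "s * P' a (b - a) + t * P' a n \<le> 0"
      using tangent[of a z] z ab by simp
    then have "s1 \<le> s"
      using bound[of "P' a n"] \<alpha> by (simp add: s1_def divide_simps mult.commute)
    have "z - b = (s - 1) *\<^sub>R (b - a) + t *\<^sub>R n"
      using s by (simp add: algebra_simps)
    then have "P' b (z - b) = (s - 1) * P' b (b - a) + t * P' b n"
      by (simp add: lins)
    then have "(s - 1) * P' b (b - a) + t * P' b n \<le> 0"
      using tangent[of b z] z ab by simp
    then have "(s - 1) * P' b (b - a) \<le> M * \<bar>P' b n\<bar>"
      using bound[of "P' b n"] by linarith
    then have "s - 1 \<le> M * \<bar>P' b n\<bar> / P' b (b - a)"
      using \<beta> by (simp add: pos_le_divide_eq)
    then have "s \<le> s2"
      by (simp add: s2_def)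
    have "z = h (s, t)"
      using s by (simp add: h_def algebra_simps)
    then show "z \<in> h ` ({s1..s2} \<times> {0..M})"
      using t0 tM \<open>s1 \<le> s\<close> \<open>s \<le> s2\<close> by auto
  qed
  moreover have "compact (h ` ({s1..s2} \<times> {0..M}))"
    unfolding h_def case_prod_unfold
    by (intro compact_continuous_image compact_Times continuous_intros compact_Icc)
  then have "compact (?A \<inter> h ` ({s1..s2} \<times> {0..M}))" if "closed ?A"
    using that by (rule closed_Int_compact[rotated])
  moreover have "closed ?A"
  proof -
    have "continuous_on UNIV P"
      by (intro continuous_at_imp_continuous_on ballI has_derivative_continuous[OF P])
    moreover have "continuous_on UNIV (\<lambda>z. P' z0 (z - a))"
      by (intro linear_continuous_on_compose[OF _ lin] continuous_intros)
    ultimately show ?thesis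
      by (intro closed_Collect_conj closed_Collect_eq closed_Collect_le continuous_intros)
  qed
  ultimately show ?thesis
    by (simp add: Int_absorb2)
qed

text \<open>The case in which P dips below \<open>c\<close> inside the segment. \<open>U\<close> is
  an open half plane bounded by the line through \<open>a\<close> and \<open>b\<close>;
  \<open>A\<close> is the part of the level set in its closure.\<close>

lemma convex_level_bounded_chord_False:
  fixes P Q :: "'a::euclidean_space \<Rightarrow> real"
  assumes dim: "DIM('a) = 2" and cvx: "convex_on UNIV P"
    and P: "\<And>z. (P has_derivative P' z) (at z)"
    and Q: "\<And>z. (Q has_derivative Q' z) (at z)"
    and ker: "\<And>z v. P' z v = 0 \<Longrightarrow> Q' z v = 0 \<Longrightarrow> v = 0"
    and ab: "P a = c" "P b = c" "Q a = Q b" "a \<noteq> b"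
    and z0: "z0 = a + s0 *\<^sub>R (b - a)" "0 < s0" "s0 < 1" "P z0 < c" "P' z0 (b - a) = 0"
  shows False
proof -
  note tangent = convex_on_tangent_le[OF cvx P]
  note lin = has_derivative_linear[OF P]
  note lins = linear_add[OF lin] linear_diff[OF lin] linear_scale[OF lin]
  define L where "L = P' z0"
  define A where "A = {z. P z = c \<and> 0 \<le> L (z - a)}"
  define U where "U = {z. 0 < L (z - a)}"
  obtain g where g: "linear g" "\<And>r. P' z0 (g r) = fst r" "\<And>r. Q' z0 (g r) = snd r"
    by (rule linear_pair_isomorphism[OF dim has_derivative_linear[OF P[of z0]] has_derivative_linear[OF Q[of z0]]])
      (auto intro: ker)
  define n where "n = g (1, 0)"
  have n: "P' z0 n = 1" "Q' z0 n = 0"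
    by (simp_all add: n_def g)
  have split: "\<exists>s. w = s *\<^sub>R (b - a) + L w *\<^sub>R n" for w
  proof -
    note linQ = has_derivative_linear[OF Q[of z0]]
    \<comment> \<open>As \<open>n\<close> lies in the kernel of \<open>Q' z0\<close> and
      \<open>b - a\<close> in that of \<open>P' z0\<close>, this \<open>s\<close> makes both forms
      vanish on the difference of the two sides.\<close>
    define s where "s = Q' z0 w / Q' z0 (b - a)"
    have "Q' z0 (b - a) \<noteq> 0"
      using ker[of z0 "b - a"] z0 ab by auto
    then have "Q' z0 (w - (s *\<^sub>R (b - a) + L w *\<^sub>R n)) = 0"
      using n by (simp add: s_def linear_diff[OF linQ, of w] linear_add[OF linQ] linear_scale[OF linQ])
    moreover have "P' z0 (w - (s *\<^sub>R (b - a) + L w *\<^sub>R n)) = 0"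
      using n z0 by (simp add: L_def linear_diff[OF lin, of _ w] linear_add[OF lin] linear_scale[OF lin])
    ultimately show ?thesis
      using ker by (metis eq_iff_diff_eq_0)
  qed
  have scale: "P' z (s *\<^sub>R (b - a)) = s * P' z (b - a)" for z s
    using linear_scale[OF lin] by simp
  have neg: "P' a (b - a) < 0"
  proof -
    have "P a + s0 * P' a (b - a) \<le> P z0"
      using tangent[of a z0] by (simp add: z0 scale)
    then have "s0 * P' a (b - a) < 0"
      using z0 ab by linarith
    then show ?thesis
      using z0 by (simp add: mult_less_0_iff)
  qed
  have pos: "0 < P' b (b - a)"
  proof -
    have "z0 - b = (s0 - 1) *\<^sub>R (b - a)"
      by (simp add: z0 algebra_simps)
    then have "P b + (s0 - 1) * P' b (b - a) \<le> P z0"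
      using tangent[of b z0] by (simp add: scale)
    then have "(s0 - 1) * P' b (b - a) < 0"
      using z0 ab by linarith
    then show ?thesis
      using z0 by (simp add: mult_less_0_iff)
  qed
  \<comment> \<open>The tangents at \<open>a\<close> and \<open>b\<close> confine a level point z of
    the line to the segment. Were it interior, the tangent at z towards both endpoints would force
    slope 0 along the chord, whereas \<open>P z0\<close> < c makes that slope nonzero.\<close>
  have chord: "s = 0 \<or> s = 1" if z: "z = a + s *\<^sub>R (b - a)" "P z = c" for z s
  proof -
    have d: "a - z = (- s) *\<^sub>R (b - a)" "b - z = (1 - s) *\<^sub>R (b - a)"
      "z0 - z = (s0 - s) *\<^sub>R (b - a)" "z - b = (s - 1) *\<^sub>R (b - a)" "z - a = s *\<^sub>R (b - a)"
      by (simp_all add: z z0 algebra_simps)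
    have "s * P' a (b - a) \<le> 0" "(s - 1) * P' b (b - a) \<le> 0"
      using tangent[of a z] tangent[of b z] z(2) ab(1,2) unfolding d scale by linarith+
    then have s01: "0 \<le> s" "s \<le> 1"
      using neg pos by (auto simp: mult_le_0_iff)
    have "- s * P' z (b - a) \<le> 0" "(1 - s) * P' z (b - a) \<le> 0" "(s0 - s) * P' z (b - a) < 0"
      using tangent[of z a] tangent[of z b] tangent[of z z0] z(2) ab(1,2) z0(4)
      unfolding d scale by linarith+
    then show ?thesis
      using s01 by (auto simp: mult_le_0_iff zero_le_mult_iff mult_less_0_iff)
  qed
  have boundary: "Q z = Q a" if "z \<in> A" "z \<notin> U" for z
  proof -
    have "L (z - a) = 0"
      using that by (auto simp: A_def U_def)
    with split[of "z - a"] obtain s where "z - a = s *\<^sub>R (b - a)"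
      by auto
    then have z: "z = a + s *\<^sub>R (b - a)"
      by (simp add: algebra_simps)
    moreover have "P z = c"
      using that by (simp add: A_def)
    ultimately have "s = 0 \<or> s = 1"
      by (rule chord)
    then show ?thesis
      using ab(3) z by auto
  qed
  have contL: "continuous_on UNIV (\<lambda>z. L (z - a))"
    unfolding L_def by (intro linear_continuous_on_compose[OF _ lin] continuous_intros)
  have openU: "open U"
    unfolding U_def by (intro open_Collect_less contL continuous_intros)
  have no_max: False if "z \<in> A" "z \<in> U" "\<And>y. y \<in> A \<Longrightarrow> Q y \<le> Q z" for z
  proof -
    have "\<exists>y\<in>U. P y = P z \<and> Q z < Q y"
      by (rule no_constrained_local_max[OF dim P Q _ openU that(2)]) (fact ker)
    then obtain y where "y \<in> U" "P y = P z" "Q z < Q y"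
      by blast
    then show False
      using that(1) that(3)[of y] by (auto simp: A_def U_def)
  qed
  have no_min: False if "z \<in> A" "z \<in> U" "\<And>y. y \<in> A \<Longrightarrow> Q z \<le> Q y" for z
  proof -
    have Qm: "((\<lambda>z. - Q z) has_derivative (\<lambda>v. - Q' z v)) (at z)" for z
      using Q by (rule has_derivative_minus)
    have "\<exists>y\<in>U. P y = P z \<and> - Q z < - Q y"
      by (rule no_constrained_local_max[OF dim P Qm _ openU that(2)]) (simp add: ker)
    then obtain y where "y \<in> U" "P y = P z" "- Q z < - Q y"
      by blast
    then show False
      using that(1) that(3)[of y] by (auto simp: A_def U_def)
  qed
  have "compact A"
    unfolding A_def L_def using split unfolding L_def
    by (intro convex_level_arc_compact[OF cvx P _ _ neg pos]) (auto simp: ab)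
  moreover have "a \<in> A"
    using lin[of z0] by (simp add: A_def L_def ab linear_0)
  moreover have contP: "continuous_on X P" and contQ: "continuous_on X Q" for X
    by (intro continuous_at_imp_continuous_on ballI has_derivative_continuous[OF P]
        has_derivative_continuous[OF Q])+
  ultimately obtain x y where xy: "x \<in> A" "\<And>z. z \<in> A \<Longrightarrow> Q z \<le> Q x" "y \<in> A" "\<And>z. z \<in> A \<Longrightarrow> Q y \<le> Q z"
    using continuous_attains_sup[of A Q] continuous_attains_inf[of A Q] by blast
  \<comment> \<open>An extremum in \<open>U\<close> is excluded, and outside \<open>U\<close> the
    arc has only the points \<open>a\<close> and \<open>b\<close>.\<close>
  have "Q x = Q a" "Q y = Q a"
    using xy boundary no_max no_min by blast+
  then have Qconst: "Q z = Q a" if "z \<in> A" for z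
    using xy that by (metis order_antisym)
  \<comment> \<open>Since \<open>P' z0 n\<close> = 1, the tangent at \<open>z0\<close> shows that P
    has reached \<open>c\<close> by t = \<open>c - P z0\<close>; the intermediate value theorem then
    yields a point of \<open>A\<close> in \<open>U\<close>.\<close>
  obtain t where t: "0 < t" "P (z0 + t *\<^sub>R n) = c"
  proof -
    have "z0 + (c - P z0) *\<^sub>R n - z0 = (c - P z0) *\<^sub>R n"
      by simp
    then have "c \<le> P (z0 + (c - P z0) *\<^sub>R n)"
      using tangent[of z0 "z0 + (c - P z0) *\<^sub>R n"] n by (simp add: linear_scale[OF lin])
    moreover have "continuous_on {0..c - P z0} (\<lambda>t. P (z0 + t *\<^sub>R n))"
      by (intro continuous_on_compose2[OF contP[of UNIV]] continuous_intros) auto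
    ultimately obtain t where "0 \<le> t" "P (z0 + t *\<^sub>R n) = c"
      using IVT'[of "\<lambda>t. P (z0 + t *\<^sub>R n)" 0 c "c - P z0"] z0(4) by auto
    moreover from this have "t \<noteq> 0"
      using z0(4) by (cases "t = 0") simp_all
    ultimately show thesis
      by (intro that[of t]) simp_all
  qed
  define w where "w = z0 + t *\<^sub>R n"
  have "w - a = s0 *\<^sub>R (b - a) + t *\<^sub>R n"
    by (simp add: w_def z0)
  then have "L (w - a) = t"
    using n z0(5) by (simp add: L_def linear_add[OF lin] linear_scale[OF lin])
  then have "w \<in> A" "w \<in> U"
    using t by (simp_all add: A_def U_def w_def)
  then show False
    using no_max Qconst by (metis order_refl)
qed

section \<open>Injectivity from the two cases for the minimum of P on the segment\<close>

lemma inj_pair_of_convex: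
  fixes P Q :: "'a::euclidean_space \<Rightarrow> real"
  assumes dim: "DIM('a) = 2" and cvx: "convex_on UNIV P"
    and P: "\<And>z. (P has_derivative P' z) (at z)"
    and Q: "\<And>z. (Q has_derivative Q' z) (at z)"
    and ker: "\<And>z v. P' z v = 0 \<Longrightarrow> Q' z v = 0 \<Longrightarrow> v = 0"
    and ab: "P a = P b" "Q a = Q b"
  shows "a = b"
proof (rule ccontr)
  assume "a \<noteq> b"
  note tangent = convex_on_tangent_le[OF cvx P]
  define h where "h s = a + s *\<^sub>R (b - a)" for s
  have h: "h 0 = a" "h 1 = b" "\<And>r s. h r - h s = (r - s) *\<^sub>R (b - a)"
    by (simp_all add: h_def algebra_simps)
  have scale: "P' z (s *\<^sub>R (b - a)) = s * P' z (b - a)" for z s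
    using linear_scale[OF has_derivative_linear[OF P]] by simp
  have along: "((\<lambda>s. f (h s)) has_real_derivative f' (h s) (b - a)) (at s)"
    if f: "\<And>z. (f has_derivative f' z) (at z)" for f f' s
  proof -
    have "(h has_derivative (\<lambda>t. t *\<^sub>R (b - a))) (at s)"
      unfolding h_def by (auto intro!: derivative_eq_intros)
    then have "((\<lambda>s. f (h s)) has_derivative (\<lambda>t. f' (h s) (t *\<^sub>R (b - a)))) (at s)"
      using f by (rule has_derivative_compose)
    moreover have "f' (h s) (t *\<^sub>R (b - a)) = f' (h s) (b - a) * t" for t
      using linear_scale[OF has_derivative_linear[OF f]] by simp
    ultimately show ?thesis
      by (simp add: has_field_derivative_def)
  qed
  have contP: "continuous_on {0..1} (\<lambda>s. P (h s))"
    by (intro continuous_at_imp_continuous_on ballI DERIV_isCont[OF along[OF P]])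
  have contQ: "continuous_on {0..1} (\<lambda>s. Q (h s))"
    by (intro continuous_at_imp_continuous_on ballI DERIV_isCont[OF along[OF Q]])
  obtain s0 where s0: "0 \<le> s0" "s0 \<le> 1" "\<And>s. 0 \<le> s \<Longrightarrow> s \<le> 1 \<Longrightarrow> P (h s0) \<le> P (h s)"
    using continuous_attains_inf[OF compact_Icc _ contP] by auto
  have Pa: "P (h s0) \<le> P a"
    using s0(3)[of 0] h by simp
  show False
  proof (cases "P (h s0) = P a")
    case True
    obtain s where s: "0 < s" "s < 1" "Q' (h s) (b - a) = 0"
    proof -
      have "Q (h 0) = Q (h 1)"
        using ab h by simp
      then have "\<exists>s. 0 < s \<and> s < 1 \<and> (\<lambda>t. Q' (h s) (b - a) * t) = (\<lambda>t. 0)"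
        using along[OF Q, unfolded has_field_derivative_def]
        by (intro Rolle_deriv[OF _ _ contQ]) simp_all
      then show thesis
        using that by (metis mult.right_neutral)
    qed
    have "P a \<le> P (h s)"
      using s0(3)[of s] s True by simp
    \<comment> \<open>With P at \<open>h s\<close> at least its value at both ends, the tangents
      towards \<open>a\<close> and \<open>b\<close> squeeze the slope of P to 0 at the very point
      where Rolle kills that of Q.\<close>
    then have "- s * P' (h s) (b - a) \<le> 0" "(1 - s) * P' (h s) (b - a) \<le> 0"
      using tangent[of "h s" "h 0"] tangent[of "h s" "h 1"] ab unfolding h(3) scale
      by (simp_all add: h(1,2))
    then have "P' (h s) (b - a) = 0"
      using s by (auto simp: zero_le_mult_iff mult_le_0_iff)
    then show False
      using ker s \<open>a \<noteq> b\<close> by fastforce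
  next
    case False
    then have "s0 \<noteq> 0" "s0 \<noteq> 1"
      using h ab by auto
    then have s01: "0 < s0" "s0 < 1"
      using s0 by auto
    have "P' (h s0) (b - a) = 0"
      \<comment> \<open>The radius keeps the neighbourhood of \<open>s0\<close> inside [0, 1], where
        \<open>s0\<close> is minimal.\<close>
      by (rule DERIV_local_min[OF along[OF P], of "min s0 (1 - s0)"])
        (use s01 s0 in \<open>auto simp: abs_if split: if_splits\<close>)
    then show False
      using False Pa ab
      by (intro convex_level_bounded_chord_False[OF dim cvx P Q _ refl _ _ \<open>a \<noteq> b\<close> h_def s01])
        (auto intro: ker)
  qed
qed

theorem theorem1:
  fixes \<Lambda> :: "real^2 \<Rightarrow> real^2"
    and P Q :: "real^2 \<Rightarrow> real"
  assumes components: "\<And>z. \<Lambda> z = vector [P z, Q z]"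
    and "C2_map \<Lambda>"
    and "nonsingular_map \<Lambda>"
    and "convex_on UNIV P \<or> convex_on UNIV Q"
  shows "inj \<Lambda>"
proof (rule injI)
  fix a b assume "\<Lambda> a = \<Lambda> b"
  have PQ: "P = (\<lambda>z. \<Lambda> z $ 1)" "Q = (\<lambda>z. \<Lambda> z $ 2)"
    by (simp_all add: components vector_2)
  obtain D :: "real^2 \<Rightarrow> (real^2) \<Rightarrow>\<^sub>L (real^2)" where D: "\<And>z. (\<Lambda> has_derivative D z) (at z)"
    using \<open>C2_map \<Lambda>\<close> unfolding C2_map_def by blast
  have P: "(P has_derivative (\<lambda>v. D z v $ 1)) (at z)" and Q: "(Q has_derivative (\<lambda>v. D z v $ 2)) (at z)" for z
    unfolding PQ using D by (rule bounded_linear.has_derivative[OF bounded_linear_vec_nth])+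
  \<comment> \<open>Uniqueness of the derivative identifies \<open>D z\<close> with the Jacobian
    matrix, so a nonzero determinant means a trivial common kernel of the two component
    derivatives.\<close>
  have ker: "v = 0" if "D z v $ 1 = 0" "D z v $ 2 = 0" for z v
  proof -
    have "(\<Lambda> has_derivative (*v) (jacobian \<Lambda> (at z))) (at z)"
      using D by (metis differentiableI jacobian_works)
    then have "D z v = jacobian \<Lambda> (at z) *v v"
      using D by (metis has_derivative_unique)
    then have "jacobian \<Lambda> (at z) *v v = 0"
      using that by (simp add: vec_eq_iff forall_2)
    moreover have "invertible (jacobian \<Lambda> (at z))"
      using \<open>nonsingular_map \<Lambda>\<close> by (simp add: nonsingular_map_def invertible_det_nz)
    ultimately show ?thesis
      by (metis invertible_left_inverse matrix_left_invertible_ker)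
  qed
  have dim: "DIM(real^2) = 2"
    by simp
  have "P a = P b" "Q a = Q b"
    using \<open>\<Lambda> a = \<Lambda> b\<close> by (simp_all add: PQ)
  from assms(4) show "a = b"
  proof
    assume "convex_on UNIV P"
    then show ?thesis
      by (rule inj_pair_of_convex[OF dim _ P Q])
        (use ker \<open>P a = P b\<close> \<open>Q a = Q b\<close> in auto)
  next
    assume "convex_on UNIV Q"
    then show ?thesis
      by (rule inj_pair_of_convex[OF dim _ Q P])
        (use ker \<open>P a = P b\<close> \<open>Q a = Q b\<close> in auto)
  qed
qed

end
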